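(* Let $A = \sigma(R)\langle x_1,\dotsc, x_n\rangle$ be a skew PBW extension over a $(\Sigma,\Delta)$-compatible and NI ring $R$. For any $f = r_0 + r_1X_1 + \cdots + r_kX_k + \cdots + r_lX_l \in A$ with $f\notin N(R)A$, there exists $r\in R$ such that $fr$ is a nilpotent good polynomial.
   Context: All rings are associative with identity, not necessarily commutative. $\mathbb{N}$ includes $0$. For a ring $R$, $N(R)$ is the set of nilpotent elements of $R$ and $N^*(R)$ is the sum of all nil ideals of $R$; $R$ is NI if $N^*(R)=N(R)$. Skew PBW extension: $A=\sigma(R)\langle x_1,\dots,x_n\rangle$ is a skew PBW extension over $R$ if (i) $R$ is a subring of $A$ with the same identity; (ii) there are $x_1,\dots,x_n\in A$ such that $A$ is a free left $R$-module with basis $\mathrm{Mon}(A)=\{x^\alpha = x_1^{\alpha_1}\cdots x_n^{\alpha_n} \mid \alpha\in\mathbb{N}^n\}$; (iii) for each $1\le i\le n$ and $r\in R\setminus\{0\}$ there is $c_{i,r}\in R\setminus\{0\}$ with $x_i r - c_{i,r}x_i\in R$; (iv) for all $1\le i,j\le n$ there is $d_{i,j}\in R\setminus\{0\}$ with $x_jx_i - d_{i,j}x_ix_j\in R+Rx_1+\cdots+Rx_n$. For such $A$ there exist, for each $i$, an injective endomorphism $\sigma_i$ of $R$ and a $\sigma_i$-derivation $\delta_i$ of $R$ (additive, $\delta_i(rs)=\sigma_i(r)\delta_i(s)+\delta_i(r)s$) with $x_ir=\sigma_i(r)x_i+\delta_i(r)$ for all $r\in R$. Put $\Sigma=\{\sigma_1,\dots,\sigma_n\}$,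 $\Delta=\{\delta_1,\dots,\delta_n\}$, and for $\alpha\in\mathbb{N}^n$, $\sigma^\alpha=\sigma_1^{\alpha_1}\circ\cdots\circ\sigma_n^{\alpha_n}$, $\delta^\alpha=\delta_1^{\alpha_1}\circ\cdots\circ\delta_n^{\alpha_n}$, $|\alpha|=\alpha_1+\cdots+\alpha_n$. $R$ is $\Sigma$-compatible if for all $a,b\in R$ and $\alpha\in\mathbb{N}^n$: $a\sigma^\alpha(b)=0$ if and only if $ab=0$. $R$ is $\Delta$-compatible if for all $a,b\in R$ and $\beta\in\mathbb{N}^n$: $ab=0$ implies $a\delta^\beta(b)=0$. $R$ is $(\Sigma,\Delta)$-compatible if it is both. A monomial order $\succeq$ on $\mathrm{Mon}(A)$ is fixed: a total order such that $x^\beta\succeq x^\alpha$ implies $\mathrm{lm}(x^\gamma x^\beta x^\lambda)\succeq\mathrm{lm}(x^\gamma x^\alpha x^\lambda)$ for all monomials (where $\mathrm{lm}$ denotes the $\succeq$-largest monomial occurring with nonzero coefficient, $\mathrm{lm}(0)=0$, and every monomial is $\succ 0$), $x^\alpha\succeq 1$ for all $\alpha$, and $|\beta|\ge|\alpha|$ implies $x^\beta\succeq x^\alpha$ (degree compatibility, so that monomials are compared first by total degree). Elements of $A$ are written $f=r_0+r_1X_1+\cdots+r_lX_l$ with $r_i\in R$, $X_i\in\mathrm{Mon}(A)$, $X_0=1$ and $X_l\succ X_{l-1}\succ\cdots\succ X_1$. For $B\subseteq R$, $BA$ denotes the set of all $\sum_i b_iX_i\in A$ with all $b_i\in B$. For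 $X\subseteq R$, the weak annihilator is $N_R(X)=\{a\in R\mid xa\in N(R)\text{ for all }x\in X\}$, and $N_R(r)=N_R(\{r\})$. Let $f=r_0+r_1X_1+\cdots+r_lX_l\notin N(R)A$, with $r_i\in R$, $X_i\in\mathrm{Mon}(A)$, $X_0=1$ and $X_l\succ X_{l-1}\succ\cdots\succ X_1$. If $r_k\notin N(R)$ and $r_i\in N(R)$ for all $i>k$, the nilpotent degree of $f$ is $k$. If $f$ has nilpotent degree $k$ and $N_R(r_k)\subseteq N_R(r_i)$ for all $i\le k$, then $f$ is called a nilpotent good polynomial (in particular a nilpotent good polynomial is not in $N(R)A$). *)

theory Defs
  imports Main
begin

text \<open>
  The big ring \<open>A\<close> is a whole type \<open>'a :: ring_1\<close> and the coefficient ring \<open>R\<close> is a subset of it.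
  Multiplication is not assumed commutative.
\<close>

section \<open>Subrings, ideals, nilpotent elements, NI rings\<close>

definition unital_subring :: "'a::ring_1 set \<Rightarrow> bool" where
  "unital_subring R \<longleftrightarrow>
     1 \<in> R \<and> (\<forall>a\<in>R. \<forall>b\<in>R. a - b \<in> R) \<and> (\<forall>a\<in>R. \<forall>b\<in>R. a * b \<in> R)"

definition two_sided_ideal :: "'a::ring_1 set \<Rightarrow> 'a set \<Rightarrow> bool" where
  "two_sided_ideal R I \<longleftrightarrow>
     I \<subseteq> R \<and> 0 \<in> I \<and> (\<forall>a\<in>I. \<forall>b\<in>I. a - b \<in> I) \<and>
     (\<forall>r\<in>R. \<forall>a\<in>I. r * a \<in> I \<and> a * r \<in> I)"

definition nilpotents :: "'a::ring_1 set \<Rightarrow> 'a set" where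
  "nilpotents R = {a \<in> R. \<exists>m::nat. a ^ m = 0}"

definition nil_ideal :: "'a::ring_1 set \<Rightarrow> 'a set \<Rightarrow> bool" where
  "nil_ideal R I \<longleftrightarrow> two_sided_ideal R I \<and> I \<subseteq> nilpotents R"

text \<open>\<open>N\<^sup>*(R)\<close>: the sum of the family of all nil ideals, i.e. all finite sums of elements taken
  from nil ideals.\<close>

definition upper_nilradical :: "'a::ring_1 set \<Rightarrow> 'a set" where
  "upper_nilradical R =
     {(\<Sum>I\<in>F. g I) | F g. finite F \<and> (\<forall>I\<in>F. nil_ideal R I \<and> g I \<in> I)}"

definition NI_ring :: "'a::ring_1 set \<Rightarrow> bool" where
  "NI_ring R \<longleftrightarrow> upper_nilradical R = nilpotents R"

text \<open>\<open>N\<^sub>R(X)\<close>; the version for one element \<open>r\<close> is \<open>weak_annihilator R {r}\<close>.\<close>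

definition weak_annihilator :: "'a::ring_1 set \<Rightarrow> 'a set \<Rightarrow> 'a set" where
  "weak_annihilator R X = {a \<in> R. \<forall>x\<in>X. x * a \<in> nilpotents R}"

section \<open>Skew PBW extensions\<close>

text \<open>\<open>\<nat>\<^sup>n\<close> is encoded by the functions \<open>nat \<Rightarrow> nat\<close> vanishing outside \<open>{1..n}\<close>.\<close>

definition exponents :: "nat \<Rightarrow> (nat \<Rightarrow> nat) set" where
  "exponents n = {\<alpha>. \<forall>i. i \<notin> {1..n} \<longrightarrow> \<alpha> i = 0}"

definition degree_exp :: "nat \<Rightarrow> (nat \<Rightarrow> nat) \<Rightarrow> nat" where
  "degree_exp n \<alpha> = (\<Sum>i=1..n. \<alpha> i)"

definition pbw_mon :: "nat \<Rightarrow> (nat \<Rightarrow> 'a::ring_1) \<Rightarrow> (nat \<Rightarrow> nat) \<Rightarrow> 'a" where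
  "pbw_mon n x \<alpha> = prod_list (map (\<lambda>i. x i ^ \<alpha> i) [1..<Suc n])"

definition pbw_expansion ::
  "'a::ring_1 set \<Rightarrow> nat \<Rightarrow> (nat \<Rightarrow> 'a) \<Rightarrow> 'a \<Rightarrow> ((nat \<Rightarrow> nat) \<Rightarrow> 'a) \<Rightarrow> bool" where
  "pbw_expansion B n x f c \<longleftrightarrow>
     finite {\<alpha>. c \<alpha> \<noteq> 0} \<and>
     (\<forall>\<alpha>. c \<alpha> \<noteq> 0 \<longrightarrow> \<alpha> \<in> exponents n \<and> c \<alpha> \<in> B) \<and>
     f = (\<Sum>\<alpha> | c \<alpha> \<noteq> 0. c \<alpha> * pbw_mon n x \<alpha>)"

text \<open>The second conjunct says that the family \<open>x^\<alpha>\<close>, \<open>\<alpha> \<in> \<nat>\<^sup>n\<close>, is a left \<open>R\<close>-basis; in particular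
  \<open>\<alpha> \<mapsto> x^\<alpha>\<close> is injective, so monomials may be identified with their exponents.\<close>

definition skew_PBW_extension :: "'a::ring_1 set \<Rightarrow> nat \<Rightarrow> (nat \<Rightarrow> 'a) \<Rightarrow> bool" where
  "skew_PBW_extension R n x \<longleftrightarrow>
     unital_subring R \<and>
     (\<forall>f. \<exists>!c. pbw_expansion R n x f c) \<and>
     (\<forall>i\<in>{1..n}. \<forall>r\<in>R - {0}. \<exists>c\<in>R - {0}. x i * r - c * x i \<in> R) \<and>
     (\<forall>i\<in>{1..n}. \<forall>j\<in>{1..n}. \<exists>d\<in>R - {0}.
        x j * x i - d * (x i * x j) \<in>
          {s 0 + (\<Sum>k=1..n. s k * x k) | s. \<forall>k\<le>n. s k \<in> R})"

text \<open>For \<open>B \<subseteq> R\<close> this is the set written \<open>BA\<close>.\<close>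

definition coeffs_in :: "'a::ring_1 set \<Rightarrow> nat \<Rightarrow> (nat \<Rightarrow> 'a) \<Rightarrow> 'a set" where
  "coeffs_in B n x = {f. \<exists>c. pbw_expansion B n x f c}"

section \<open>The maps \<open>\<sigma>\<^sub>i\<close>, \<open>\<delta>\<^sub>i\<close> and compatibility\<close>

definition injective_endo :: "'a::ring_1 set \<Rightarrow> ('a \<Rightarrow> 'a) \<Rightarrow> bool" where
  "injective_endo R s \<longleftrightarrow>
     s ` R \<subseteq> R \<and> inj_on s R \<and> s 1 = 1 \<and>
     (\<forall>a\<in>R. \<forall>b\<in>R. s (a + b) = s a + s b \<and> s (a * b) = s a * s b)"

definition skew_derivation :: "'a::ring_1 set \<Rightarrow> ('a \<Rightarrow> 'a) \<Rightarrow> ('a \<Rightarrow> 'a) \<Rightarrow> bool" where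
  "skew_derivation R s d \<longleftrightarrow>
     d ` R \<subseteq> R \<and>
     (\<forall>a\<in>R. \<forall>b\<in>R. d (a + b) = d a + d b \<and> d (a * b) = s a * d b + d a * b)"

text \<open>In a skew PBW extension such \<open>\<sigma>\<^sub>i\<close> and \<open>\<delta>\<^sub>i\<close> always exist, and freeness determines them
  uniquely on \<open>R\<close>.\<close>

definition pbw_structure_maps ::
  "'a::ring_1 set \<Rightarrow> nat \<Rightarrow> (nat \<Rightarrow> 'a) \<Rightarrow> (nat \<Rightarrow> 'a \<Rightarrow> 'a) \<Rightarrow> (nat \<Rightarrow> 'a \<Rightarrow> 'a) \<Rightarrow> bool" where
  "pbw_structure_maps R n x \<sigma> \<delta> \<longleftrightarrow>
     (\<forall>i\<in>{1..n}. injective_endo R (\<sigma> i) \<and> skew_derivation R (\<sigma> i) (\<delta> i) \<and>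
        (\<forall>r\<in>R. x i * r = \<sigma> i r * x i + \<delta> i r))"

text \<open>\<open>h\<^sub>1^\<alpha>\<^sub>1 \<circ> \<cdots> \<circ> h\<^sub>n^\<alpha>\<^sub>n\<close>\<close>

definition multi_compose :: "nat \<Rightarrow> (nat \<Rightarrow> 'a \<Rightarrow> 'a) \<Rightarrow> (nat \<Rightarrow> nat) \<Rightarrow> 'a \<Rightarrow> 'a" where
  "multi_compose n h \<alpha> = foldr (\<circ>) (map (\<lambda>i. h i ^^ \<alpha> i) [1..<Suc n]) id"

definition Sigma_compatible :: "'a::ring_1 set \<Rightarrow> nat \<Rightarrow> (nat \<Rightarrow> 'a \<Rightarrow> 'a) \<Rightarrow> bool" where
  "Sigma_compatible R n \<sigma> \<longleftrightarrow>
     (\<forall>a\<in>R. \<forall>b\<in>R. \<forall>\<alpha>\<in>exponents n. a * multi_compose n \<sigma> \<alpha> b = 0 \<longleftrightarrow> a * b = 0)"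

definition Delta_compatible :: "'a::ring_1 set \<Rightarrow> nat \<Rightarrow> (nat \<Rightarrow> 'a \<Rightarrow> 'a) \<Rightarrow> bool" where
  "Delta_compatible R n \<delta> \<longleftrightarrow>
     (\<forall>a\<in>R. \<forall>b\<in>R. \<forall>\<beta>\<in>exponents n. a * b = 0 \<longrightarrow> a * multi_compose n \<delta> \<beta> b = 0)"

definition Sigma_Delta_compatible ::
  "'a::ring_1 set \<Rightarrow> nat \<Rightarrow> (nat \<Rightarrow> 'a \<Rightarrow> 'a) \<Rightarrow> (nat \<Rightarrow> 'a \<Rightarrow> 'a) \<Rightarrow> bool" where
  "Sigma_Delta_compatible R n \<sigma> \<delta> \<longleftrightarrow> Sigma_compatible R n \<sigma> \<and> Delta_compatible R n \<delta>"

section \<open>Monomial orders\<close>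

definition pbw_coeff :: "'a::ring_1 set \<Rightarrow> nat \<Rightarrow> (nat \<Rightarrow> 'a) \<Rightarrow> 'a \<Rightarrow> (nat \<Rightarrow> nat) \<Rightarrow> 'a" where
  "pbw_coeff R n x f = (THE c. pbw_expansion R n x f c)"

text \<open>Orders are relations \<open>ord\<close> on exponents: \<open>(\<alpha>, \<beta>) \<in> ord\<close> means \<open>x^\<alpha> \<preceq> x^\<beta>\<close>.
  \<open>None\<close> stands for \<open>lm(0) = 0\<close>, which lies below every monomial.\<close>

definition leading_mon ::
  "'a::ring_1 set \<Rightarrow> nat \<Rightarrow> (nat \<Rightarrow> 'a) \<Rightarrow> (nat \<Rightarrow> nat) rel \<Rightarrow> 'a \<Rightarrow> (nat \<Rightarrow> nat) option" where
  "leading_mon R n x ord f =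
     (if f = 0 then None
      else Some (THE \<alpha>. pbw_coeff R n x f \<alpha> \<noteq> 0 \<and>
                        (\<forall>\<beta>. pbw_coeff R n x f \<beta> \<noteq> 0 \<longrightarrow> (\<beta>, \<alpha>) \<in> ord)))"

fun lm_le :: "(nat \<Rightarrow> nat) rel \<Rightarrow> (nat \<Rightarrow> nat) option \<Rightarrow> (nat \<Rightarrow> nat) option \<Rightarrow> bool" where
  "lm_le ord None u = True"
| "lm_le ord (Some \<alpha>) None = False"
| "lm_le ord (Some \<alpha>) (Some \<beta>) = ((\<alpha>, \<beta>) \<in> ord)"

text \<open>Degree compatibility is stated with a strict inequality of degrees. With \<open>|\<alpha>| \<le> |\<beta>|\<close>,
  distinct monomials of equal degree would each be \<open>\<succeq>\<close> the other, contradicting antisymmetry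
  as soon as \<open>n \<ge> 2\<close>.\<close>

definition monomial_order ::
  "'a::ring_1 set \<Rightarrow> nat \<Rightarrow> (nat \<Rightarrow> 'a) \<Rightarrow> (nat \<Rightarrow> nat) rel \<Rightarrow> bool" where
  "monomial_order R n x ord \<longleftrightarrow>
     linear_order_on (exponents n) ord \<and>
     (\<forall>\<alpha>\<in>exponents n. \<forall>\<beta>\<in>exponents n. \<forall>\<gamma>\<in>exponents n. \<forall>\<epsilon>\<in>exponents n.
        (\<alpha>, \<beta>) \<in> ord \<longrightarrow>
        lm_le ord
          (leading_mon R n x ord (pbw_mon n x \<gamma> * pbw_mon n x \<alpha> * pbw_mon n x \<epsilon>))
          (leading_mon R n x ord (pbw_mon n x \<gamma> * pbw_mon n x \<beta> * pbw_mon n x \<epsilon>))) \<and>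
     (\<forall>\<alpha>\<in>exponents n. ((\<lambda>_. 0), \<alpha>) \<in> ord) \<and>
     (\<forall>\<alpha>\<in>exponents n. \<forall>\<beta>\<in>exponents n.
        degree_exp n \<alpha> < degree_exp n \<beta> \<longrightarrow> (\<alpha>, \<beta>) \<in> ord)"

section \<open>Nilpotent good polynomials\<close>

text \<open>\<open>f = r\<^sub>0 + r\<^sub>1 X\<^sub>1 + \<cdots> + r\<^sub>l X\<^sub>l\<close> with \<open>1 = X\<^sub>0 \<prec> X\<^sub>1 \<prec> \<cdots> \<prec> X\<^sub>l\<close>, where \<open>X i\<close> is the exponent of
  the \<open>i\<close>-th monomial. Coefficients may be zero.\<close>

definition standard_form ::
  "'a::ring_1 set \<Rightarrow> nat \<Rightarrow> (nat \<Rightarrow> 'a) \<Rightarrow> (nat \<Rightarrow> nat) rel \<Rightarrow> 'a \<Rightarrow>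
   nat \<Rightarrow> (nat \<Rightarrow> 'a) \<Rightarrow> (nat \<Rightarrow> (nat \<Rightarrow> nat)) \<Rightarrow> bool" where
  "standard_form R n x ord f l r X \<longleftrightarrow>
     (\<forall>i\<le>l. r i \<in> R \<and> X i \<in> exponents n) \<and>
     X 0 = (\<lambda>_. 0) \<and>
     (\<forall>i<l. (X i, X (Suc i)) \<in> ord \<and> X i \<noteq> X (Suc i)) \<and>
     f = (\<Sum>i\<le>l. r i * pbw_mon n x (X i))"

definition nilpotent_degree :: "'a::ring_1 set \<Rightarrow> nat \<Rightarrow> (nat \<Rightarrow> 'a) \<Rightarrow> nat \<Rightarrow> bool" where
  "nilpotent_degree R l r k \<longleftrightarrow>
     k \<le> l \<and> r k \<notin> nilpotents R \<and> (\<forall>i. k < i \<and> i \<le> l \<longrightarrow> r i \<in> nilpotents R)"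

text \<open>Two standard forms of \<open>f\<close> differ only by terms with coefficient \<open>0\<close>, and
  \<open>weak_annihilator R {0} = R\<close>; hence the condition below does not depend on the standard form
  chosen, although the index \<open>k\<close> does.\<close>

definition nilpotent_good ::
  "'a::ring_1 set \<Rightarrow> nat \<Rightarrow> (nat \<Rightarrow> 'a) \<Rightarrow> (nat \<Rightarrow> nat) rel \<Rightarrow> 'a \<Rightarrow> bool" where
  "nilpotent_good R n x ord f \<longleftrightarrow>
     f \<notin> coeffs_in (nilpotents R) n x \<and>
     (\<exists>l r X k. standard_form R n x ord f l r X \<and> nilpotent_degree R l r k \<and>
        (\<forall>i\<le>k. weak_annihilator R {r k} \<subseteq> weak_annihilator R {r i}))"

end

theory Submission
  imports Defs
begin

text \<open>
  Let \<open>N\<close> be the set of nilpotent elements of \<open>R\<close>.  Because \<open>R\<close> is NI, \<open>N\<close> is an ideal, and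
  compatibility survives passing to \<open>R/N\<close>: if \<open>ub\<close> lies in \<open>N\<close>, then so do \<open>u\<sigma>\<^sub>i(b)\<close> and
  \<open>u\<delta>\<^sub>i(b)\<close>, and conversely \<open>u\<sigma>\<^sub>i(b) \<in> N\<close> forces \<open>ub \<in> N\<close> (\<open>nil_\<sigma>\<close>, \<open>nil_\<delta>\<close>).

  Moving a scalar \<open>a\<close> from the right of a monomial \<open>x^\<alpha>\<close> to its left produces terms
  \<open>q x^\<gamma>\<close> with \<open>\<gamma> = \<alpha>\<close> or \<open>|\<gamma>| < |\<alpha>|\<close>.  Each \<open>q\<close> is a sum of values at \<open>a\<close> of
  compositions of the \<open>\<sigma>\<^sub>i\<close> and \<open>\<delta>\<^sub>i\<close>, and for \<open>\<gamma> = \<alpha>\<close> only the \<open>\<sigma>\<^sub>i\<close> occur.  Hence, for a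
  coefficient \<open>u\<close>, \<open>ua \<in> N\<close> makes the whole of \<open>u x^\<alpha> a\<close> vanish modulo \<open>N\<close>, whereas
  \<open>ua \<notin> N\<close> makes its coefficient at \<open>x^\<alpha>\<close> survive (\<open>coeff_mon_times\<close>).

  Call the greatest monomial of \<open>g\<close> with coefficient outside \<open>N\<close> its leading monomial modulo
  \<open>N\<close>.  If \<open>g\<close> is not good, there is an \<open>a\<close> that kills the leading coefficient modulo \<open>N\<close> but
  does not kill some other coefficient.  Then \<open>ga\<close> has a strictly smaller leading monomial
  (\<open>nil_lead_decreases\<close>) and still has a coefficient outside \<open>N\<close> (\<open>not_all_nil_times\<close>), so \<open>g\<close>
  can be replaced by \<open>ga\<close>.  A degree-compatible order has only finitely many monomials below a
  given one, so starting from \<open>f\<close> this stops, at a good multiple \<open>fr\<close>.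
\<close>

section \<open>The nilpotent elements of an NI ring\<close>

locale NI_subring =
  fixes R :: "'a::ring_1 set"
  assumes subring: "unital_subring R" and NI: "NI_ring R"
begin

abbreviation "N \<equiv> nilpotents R"

lemma one_in: "1 \<in> R"
  and diff_in: "a \<in> R \<Longrightarrow> b \<in> R \<Longrightarrow> a - b \<in> R"
  and mult_in: "a \<in> R \<Longrightarrow> b \<in> R \<Longrightarrow> a * b \<in> R"
  using subring by (auto simp: unital_subring_def)

lemma zero_in: "0 \<in> R"
  using diff_in[OF one_in one_in] by simp

lemma add_in: "a \<in> R \<Longrightarrow> b \<in> R \<Longrightarrow> a + b \<in> R"
  using diff_in[of a "0 - b"] diff_in[OF zero_in, of b] by simp

lemma nil_in: "a \<in> N \<Longrightarrow> a \<in> R"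
  by (simp add: nilpotents_def)

lemma nil_zero: "0 \<in> N"
  using zero_in by (auto simp: nilpotents_def intro: exI[of _ 1])

lemma nil_sum_form:
  assumes "a \<in> N"
  obtains F g where "finite F" "\<And>I. I \<in> F \<Longrightarrow> nil_ideal R I" "\<And>I. I \<in> F \<Longrightarrow> g I \<in> I"
    "a = (\<Sum>I\<in>F. g I)"
proof -
  have "a \<in> upper_nilradical R"
    using assms NI by (simp add: NI_ring_def)
  then show thesis
    unfolding upper_nilradical_def using that by (elim CollectE exE conjE) metis
qed

lemma nil_sum_formI:
  assumes "finite F" "\<And>I. I \<in> F \<Longrightarrow> nil_ideal R I" "\<And>I. I \<in> F \<Longrightarrow> g I \<in> I"
  shows "(\<Sum>I\<in>F. g I) \<in> N"
proof -
  have "(\<Sum>I\<in>F. g I) \<in> upper_nilradical R"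
    unfolding upper_nilradical_def using assms by (intro CollectI exI conjI ballI) auto
  then show ?thesis
    using NI by (simp add: NI_ring_def)
qed

text \<open>
  The elements of \<open>N\<close> are the sums of elements of nil ideals.  Both families of summands are
  extended by \<open>0\<close> to the union of their index sets and subtracted ideal by ideal.
\<close>

lemma nil_diff:
  assumes "a \<in> N" "b \<in> N"
  shows "a - b \<in> N"
proof -
  obtain F g where F: "finite F" "\<And>I. I \<in> F \<Longrightarrow> nil_ideal R I" "\<And>I. I \<in> F \<Longrightarrow> g I \<in> I"
    "a = (\<Sum>I\<in>F. g I)" using nil_sum_form[OF assms(1)] by blast
  obtain G h where G: "finite G" "\<And>I. I \<in> G \<Longrightarrow> nil_ideal R I" "\<And>I. I \<in> G \<Longrightarrow> h I \<in> I"
    "b = (\<Sum>I\<in>G. h I)" using nil_sum_form[OF assms(2)] by blast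
  define g' where "g' I = (if I \<in> F then g I else 0)" for I
  define h' where "h' I = (if I \<in> G then h I else 0)" for I
  have "a = (\<Sum>I\<in>F \<union> G. g' I)"
    unfolding F(4) g'_def by (rule sum.mono_neutral_cong_left) (use F(1) G(1) in auto)
  moreover have "b = (\<Sum>I\<in>F \<union> G. h' I)"
    unfolding G(4) h'_def by (rule sum.mono_neutral_cong_left) (use F(1) G(1) in auto)
  ultimately have diff: "a - b = (\<Sum>I\<in>F \<union> G. g' I - h' I)"
    by (simp add: sum_subtractf)
  have mem: "g' I - h' I \<in> I" if I: "I \<in> F \<union> G" for I
  proof -
    have ideal: "two_sided_ideal R I"
      using I F(2) G(2) by (auto simp: nil_ideal_def)
    then have "g' I \<in> I" "h' I \<in> I"
      using F(3) G(3) by (auto simp: g'_def h'_def two_sided_ideal_def)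
    then show ?thesis
      using ideal by (auto simp: two_sided_ideal_def)
  qed
  show ?thesis
    unfolding diff
  proof (rule nil_sum_formI)
    show "finite (F \<union> G)"
      using F(1) G(1) by (rule finite_UnI)
    show "nil_ideal R I" if "I \<in> F \<union> G" for I
      using that F(2) G(2) by blast
  qed (rule mem)
qed

lemma nil_add:
  assumes "a \<in> N" "b \<in> N"
  shows "a + b \<in> N"
  using nil_diff[OF assms(1) nil_diff[OF nil_zero assms(2)]] by simp

lemma nil_sum: "(\<And>i. i \<in> S \<Longrightarrow> g i \<in> N) \<Longrightarrow> (\<Sum>i\<in>S. g i) \<in> N"
  by (induction S rule: infinite_finite_induct) (auto simp: nil_zero nil_add)

lemma nil_mult_right:
  assumes "a \<in> N" "r \<in> R"
  shows "a * r \<in> N"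
proof -
  obtain F g where F: "finite F" "\<And>I. I \<in> F \<Longrightarrow> nil_ideal R I" "\<And>I. I \<in> F \<Longrightarrow> g I \<in> I"
    "a = (\<Sum>I\<in>F. g I)" using nil_sum_form[OF assms(1)] by blast
  have "g I * r \<in> I" if "I \<in> F" for I
    using F(2,3)[OF that] assms(2) by (auto simp: nil_ideal_def two_sided_ideal_def)
  then show ?thesis
    unfolding F(4) sum_distrib_right by (intro nil_sum_formI F(1,2))
qed

end

section \<open>Expansions in the monomial basis\<close>

lemma pbw_mon_zero [simp]: "pbw_mon n x (\<lambda>_. 0) = 1"
  by (simp add: pbw_mon_def map_replicate_const)

lemma prod_list_one:
  fixes xs :: "'b::monoid_mult list"
  shows "(\<And>y. y \<in> set xs \<Longrightarrow> y = 1) \<Longrightarrow> prod_list xs = 1"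
  by (induction xs) auto

lemma upt_split:
  assumes "i \<in> {1..n}"
  shows "[1..<Suc n] = [1..<i] @ i # [Suc i..<Suc n]"
proof -
  have "[1..<Suc n] = [1..<i] @ [i..<Suc n]"
    using assms upt_add_eq_append[of 1 i "Suc n - i"] by simp
  also have "[i..<Suc n] = i # [Suc i..<Suc n]"
    using assms by (intro upt_conv_Cons) auto
  finally show ?thesis .
qed

text \<open>
  Multiplying by a variable that precedes every variable of the monomial keeps the factors in
  order, so the product is again a monomial.
\<close>

lemma var_times_mon:
  assumes i: "i \<in> {1..n}" and low: "\<And>j. j < i \<Longrightarrow> \<alpha> j = 0"
  shows "x i * pbw_mon n x \<alpha> = pbw_mon n x (\<alpha>(i := Suc (\<alpha> i)))"
proof -
  let ?B = "[Suc i..<Suc n]"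
  have *: "pbw_mon n x \<beta> = x i ^ \<beta> i * prod_list (map (\<lambda>j. x j ^ \<beta> j) ?B)"
    if "\<And>j. j < i \<Longrightarrow> \<beta> j = 0" for \<beta> :: "nat \<Rightarrow> nat"
  proof -
    have "prod_list (map (\<lambda>j. x j ^ \<beta> j) [1..<i]) = 1"
      using that by (intro prod_list_one) auto
    then show ?thesis
      unfolding pbw_mon_def upt_split[OF i] by simp
  qed
  have "prod_list (map (\<lambda>j. x j ^ (if j = i then Suc (\<alpha> i) else \<alpha> j)) ?B) =
    prod_list (map (\<lambda>j. x j ^ \<alpha> j) ?B)"
    by (intro arg_cong[of _ _ prod_list] map_cong) auto
  then show ?thesis
    using *[of \<alpha>] *[of "\<alpha>(i := Suc (\<alpha> i))"] low by (simp add: mult.assoc del: upt_Suc)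
qed

lemma degree_exp_incr:
  assumes "i \<in> {1..n}"
  shows "degree_exp n (\<alpha>(i := Suc (\<alpha> i))) = Suc (degree_exp n \<alpha>)"
proof -
  have split: "degree_exp n \<beta> = \<beta> i + (\<Sum>j\<in>{1..n} - {i}. \<beta> j)" for \<beta>
    unfolding degree_exp_def by (rule sum.remove[OF _ assms]) simp
  have "(\<Sum>j\<in>{1..n} - {i}. (\<alpha>(i := Suc (\<alpha> i))) j) = (\<Sum>j\<in>{1..n} - {i}. \<alpha> j)"
    by (rule sum.cong) auto
  then show ?thesis
    unfolding split by (simp only: fun_upd_same add_Suc)
qed

locale skew_PBW =
  fixes R :: "'a::ring_1 set" and n :: nat and x :: "nat \<Rightarrow> 'a" and \<sigma> \<delta> :: "nat \<Rightarrow> 'a \<Rightarrow> 'a"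
  assumes ext: "skew_PBW_extension R n x"
    and maps: "pbw_structure_maps R n x \<sigma> \<delta>"
    and compat: "Sigma_Delta_compatible R n \<sigma> \<delta>"
    and NI': "NI_ring R"
begin

sublocale NI_subring R
  using ext NI' by unfold_locales (auto simp: skew_PBW_extension_def)

abbreviation "mon \<equiv> pbw_mon n x"
abbreviation "coeff \<equiv> pbw_coeff R n x"

lemma coeff_expansion: "pbw_expansion R n x g (coeff g)"
  using ext unfolding pbw_coeff_def skew_PBW_extension_def by (metis theI')

lemma coeff_unique: "pbw_expansion R n x g c \<Longrightarrow> coeff g = c"
  using ext coeff_expansion[of g] unfolding skew_PBW_extension_def by metis

lemma finite_support: "finite {\<alpha>. coeff g \<alpha> \<noteq> 0}"
  using coeff_expansion unfolding pbw_expansion_def by blast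

lemma support_exponents: "coeff g \<alpha> \<noteq> 0 \<Longrightarrow> \<alpha> \<in> exponents n"
  using coeff_expansion unfolding pbw_expansion_def by blast

lemma coeff_in: "coeff g \<alpha> \<in> R"
  using coeff_expansion zero_in unfolding pbw_expansion_def by metis

lemma expand: "finite S \<Longrightarrow> {\<alpha>. coeff g \<alpha> \<noteq> 0} \<subseteq> S \<Longrightarrow> g = (\<Sum>\<alpha>\<in>S. coeff g \<alpha> * mon \<alpha>)"
proof -
  assume "finite S" "{\<alpha>. coeff g \<alpha> \<noteq> 0} \<subseteq> S"
  then have "(\<Sum>\<alpha> | coeff g \<alpha> \<noteq> 0. coeff g \<alpha> * mon \<alpha>) = (\<Sum>\<alpha>\<in>S. coeff g \<alpha> * mon \<alpha>)"
    by (intro sum.mono_neutral_left) auto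
  then show ?thesis
    using coeff_expansion[of g] unfolding pbw_expansion_def by simp
qed

lemma coeff_eqI:
  assumes "finite S" "S \<subseteq> exponents n" "\<And>\<alpha>. \<alpha> \<in> S \<Longrightarrow> c \<alpha> \<in> R" "\<And>\<alpha>. \<alpha> \<notin> S \<Longrightarrow> c \<alpha> = 0"
    and "g = (\<Sum>\<alpha>\<in>S. c \<alpha> * mon \<alpha>)"
  shows "coeff g = c"
proof (rule coeff_unique)
  have sub: "{\<alpha>. c \<alpha> \<noteq> 0} \<subseteq> S" using assms(4) by auto
  have "(\<Sum>\<alpha> | c \<alpha> \<noteq> 0. c \<alpha> * mon \<alpha>) = (\<Sum>\<alpha>\<in>S. c \<alpha> * mon \<alpha>)"
    using assms(1) sub by (intro sum.mono_neutral_left) auto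
  then show "pbw_expansion R n x g c"
    unfolding pbw_expansion_def using sub assms finite_subset[OF sub] by auto
qed

lemma coeff_add: "coeff (g + h) \<gamma> = coeff g \<gamma> + coeff h \<gamma>"
proof -
  let ?S = "{\<alpha>. coeff g \<alpha> \<noteq> 0} \<union> {\<alpha>. coeff h \<alpha> \<noteq> 0}"
  have "coeff (g + h) = (\<lambda>\<gamma>. coeff g \<gamma> + coeff h \<gamma>)"
  proof (rule coeff_eqI)
    show "finite ?S" using finite_support by blast
    then show "g + h = (\<Sum>\<alpha>\<in>?S. (coeff g \<alpha> + coeff h \<alpha>) * mon \<alpha>)"
      using expand[of ?S g] expand[of ?S h] by (simp add: distrib_right sum.distrib)
  qed (auto simp: coeff_in add_in support_exponents)
  then show ?thesis by simp
qed

lemma coeff_zero: "coeff 0 \<gamma> = 0"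
  using coeff_add[of 0 0 \<gamma>] by simp

lemma coeff_sum: "coeff (\<Sum>i\<in>S. g i) \<gamma> = (\<Sum>i\<in>S. coeff (g i) \<gamma>)"
  by (induction S rule: infinite_finite_induct) (auto simp: coeff_zero coeff_add)

lemma coeff_scale:
  assumes "r \<in> R"
  shows "coeff (r * g) \<gamma> = r * coeff g \<gamma>"
proof -
  let ?S = "{\<alpha>. coeff g \<alpha> \<noteq> 0}"
  have "coeff (r * g) = (\<lambda>\<gamma>. r * coeff g \<gamma>)"
  proof (rule coeff_eqI)
    show "finite ?S" by (rule finite_support)
    then have "r * g = r * (\<Sum>\<alpha>\<in>?S. coeff g \<alpha> * mon \<alpha>)"
      using expand[of ?S g] by simp
    then show "r * g = (\<Sum>\<alpha>\<in>?S. (r * coeff g \<alpha>) * mon \<alpha>)"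
      by (simp add: sum_distrib_left mult.assoc)
  qed (auto simp: coeff_in mult_in support_exponents assms)
  then show ?thesis by simp
qed

lemma coeff_term:
  assumes "r \<in> R" "\<alpha> \<in> exponents n"
  shows "coeff (r * mon \<alpha>) \<gamma> = (if \<gamma> = \<alpha> then r else 0)"
proof -
  have "coeff (r * mon \<alpha>) = (\<lambda>\<gamma>. if \<gamma> = \<alpha> then r else 0)"
    by (rule coeff_eqI[of "{\<alpha>}"]) (use assms in auto)
  then show ?thesis by simp
qed

lemma coeff_times:
  "coeff (g * h) \<gamma> = (\<Sum>\<alpha> | coeff g \<alpha> \<noteq> 0. coeff g \<alpha> * coeff (mon \<alpha> * h) \<gamma>)"
proof -
  have "g * h = (\<Sum>\<alpha> | coeff g \<alpha> \<noteq> 0. coeff g \<alpha> * (mon \<alpha> * h))"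
    using arg_cong[OF expand[OF finite_support[of g] subset_refl], of "\<lambda>t. t * h"]
    by (simp add: sum_distrib_right mult.assoc)
  then show ?thesis
    by (simp add: coeff_sum coeff_scale coeff_in)
qed

lemma in_coeffs_in_nilpotents: "g \<in> coeffs_in N n x \<longleftrightarrow> (\<forall>\<alpha>. coeff g \<alpha> \<in> N)"
proof
  assume "g \<in> coeffs_in N n x"
  then obtain c where c: "pbw_expansion N n x g c"
    by (auto simp: coeffs_in_def)
  then have "pbw_expansion R n x g c"
    using nil_in by (auto simp: pbw_expansion_def)
  then have "coeff g = c"
    by (rule coeff_unique)
  then show "\<forall>\<alpha>. coeff g \<alpha> \<in> N"
    using c nil_zero unfolding pbw_expansion_def by metis
next
  assume "\<forall>\<alpha>. coeff g \<alpha> \<in> N"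
  then have "pbw_expansion N n x g (coeff g)"
    using coeff_expansion[of g] by (auto simp: pbw_expansion_def)
  then show "g \<in> coeffs_in N n x"
    by (auto simp: coeffs_in_def)
qed

section \<open>Compatibility modulo the nilpotent elements\<close>

lemma
  assumes "i \<in> {1..n}"
  shows \<sigma>_in: "a \<in> R \<Longrightarrow> \<sigma> i a \<in> R"
    and \<delta>_in: "a \<in> R \<Longrightarrow> \<delta> i a \<in> R"
    and \<sigma>_mult: "a \<in> R \<Longrightarrow> b \<in> R \<Longrightarrow> \<sigma> i (a * b) = \<sigma> i a * \<sigma> i b"
    and \<delta>_mult: "a \<in> R \<Longrightarrow> b \<in> R \<Longrightarrow> \<delta> i (a * b) = \<sigma> i a * \<delta> i b + \<delta> i a * b"
    and \<sigma>_add: "a \<in> R \<Longrightarrow> b \<in> R \<Longrightarrow> \<sigma> i (a + b) = \<sigma> i a + \<sigma> i b"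
    and \<delta>_add: "a \<in> R \<Longrightarrow> b \<in> R \<Longrightarrow> \<delta> i (a + b) = \<delta> i a + \<delta> i b"
    and var_mult: "a \<in> R \<Longrightarrow> x i * a = \<sigma> i a * x i + \<delta> i a"
  using maps assms
  by (auto simp: pbw_structure_maps_def injective_endo_def skew_derivation_def image_subset_iff)

lemma \<sigma>_zero: "i \<in> {1..n} \<Longrightarrow> \<sigma> i 0 = 0"
  and \<delta>_zero: "i \<in> {1..n} \<Longrightarrow> \<delta> i 0 = 0"
  using \<sigma>_add[of i 0 0] \<delta>_add[of i 0 0] zero_in by auto

lemma multi_compose_single:
  assumes "i \<in> {1..n}"
  shows "multi_compose n h ((\<lambda>_. 0)(i := 1)) = h i"
proof -
  let ?e = "(\<lambda>_. 0)(i := 1) :: nat \<Rightarrow> nat"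
  have trivial: "foldr (\<circ>) (map (\<lambda>j. h j ^^ ?e j) js) g = g" if "i \<notin> set js" for js g
    using that by (induction js) auto
  have "i \<notin> set [1..<i]" "i \<notin> set [Suc i..<Suc n]"
    by auto
  note trivial = this[THEN trivial]
  have "multi_compose n h ?e = (h i ^^ ?e i) \<circ> id"
    unfolding multi_compose_def upt_split[OF assms]
    by (simp only: map_append list.map foldr_append foldr.simps comp_apply trivial)
  then show ?thesis
    by simp
qed

lemma
  assumes "i \<in> {1..n}" "a \<in> R" "b \<in> R"
  shows zero_\<sigma>: "a * \<sigma> i b = 0 \<longleftrightarrow> a * b = 0"
    and zero_\<delta>: "a * b = 0 \<Longrightarrow> a * \<delta> i b = 0"
proof -
  have "(\<lambda>_. 0)(i := 1) \<in> exponents n"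
    using assms(1) by (auto simp: exponents_def)
  then show "a * \<sigma> i b = 0 \<longleftrightarrow> a * b = 0" "a * b = 0 \<Longrightarrow> a * \<delta> i b = 0"
    using compat assms multi_compose_single[OF assms(1)]
    unfolding Sigma_Delta_compatible_def Sigma_compatible_def Delta_compatible_def by metis+
qed

text \<open>
  Compatibility concerns only a right-hand factor.  For a factor inside a product, apply it to
  \<open>b * v\<close> and expand \<open>\<sigma>\<^sub>i(b * v) = \<sigma>\<^sub>i(b) * \<sigma>\<^sub>i(v)\<close>; the outer \<open>\<sigma>\<^sub>i(v)\<close> is then traded
  for \<open>v\<close>.
\<close>

lemma zero_\<sigma>_inner:
  assumes "i \<in> {1..n}" "u \<in> R" "b \<in> R" "v \<in> R"
  shows "u * \<sigma> i b * v = 0 \<longleftrightarrow> u * b * v = 0"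
proof -
  have "u * \<sigma> i b * v = 0 \<longleftrightarrow> u * \<sigma> i b * \<sigma> i v = 0"
    using assms by (simp add: zero_\<sigma> mult_in \<sigma>_in)
  also have "\<dots> \<longleftrightarrow> u * \<sigma> i (b * v) = 0"
    using assms by (simp add: \<sigma>_mult mult.assoc)
  also have "\<dots> \<longleftrightarrow> u * b * v = 0"
    using assms by (simp add: zero_\<sigma> mult_in mult.assoc)
  finally show ?thesis .
qed

text \<open>
  Here \<open>u * \<delta>\<^sub>i(b * v) = u * \<sigma>\<^sub>i(b) * \<delta>\<^sub>i(v) + u * \<delta>\<^sub>i(b) * v\<close>, and both the left-hand side
  and the first summand vanish by compatibility.
\<close>

lemma zero_\<delta>_inner:
  assumes "i \<in> {1..n}" "u \<in> R" "b \<in> R" "v \<in> R" and zero: "u * b * v = 0"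
  shows "u * \<delta> i b * v = 0"
proof -
  have "u * \<sigma> i b * v = 0"
    using zero_\<sigma>_inner assms by blast
  then have "u * \<sigma> i b * \<delta> i v = 0"
    using assms by (intro zero_\<delta>) (auto simp: mult_in \<sigma>_in)
  moreover have "u * \<delta> i (b * v) = 0"
    using zero assms by (intro zero_\<delta>) (auto simp: mult_in mult.assoc)
  ultimately show ?thesis
    using assms by (simp add: \<delta>_mult distrib_left mult.assoc)
qed

lemma power_in: "a \<in> R \<Longrightarrow> a ^ m \<in> R"
  by (induction m) (auto simp: one_in mult_in)

text \<open>
  The factors \<open>b\<close> of \<open>(a * b) ^ m\<close> are replaced by \<open>\<sigma>\<^sub>i(b)\<close> one at a time, from left to right.
  The prefix already treated is collected in \<open>u\<close>.
\<close>

lemma nil_\<sigma>: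
  assumes i: "i \<in> {1..n}" and "a \<in> R" "b \<in> R"
  shows "a * \<sigma> i b \<in> N \<longleftrightarrow> a * b \<in> N"
proof -
  have "u * (a * \<sigma> i b) ^ m = 0 \<longleftrightarrow> u * (a * b) ^ m = 0" if "u \<in> R" for u m
    using that
  proof (induction m arbitrary: u)
    case (Suc m)
    have "u * (a * \<sigma> i b) ^ Suc m = 0 \<longleftrightarrow> (u * a * \<sigma> i b) * (a * \<sigma> i b) ^ m = 0"
      by (simp add: mult.assoc)
    also have "\<dots> \<longleftrightarrow> (u * a) * \<sigma> i b * (a * b) ^ m = 0"
      using Suc assms by (simp add: mult_in \<sigma>_in)
    also have "\<dots> \<longleftrightarrow> (u * a) * b * (a * b) ^ m = 0"
      using Suc.prems assms by (intro zero_\<sigma>_inner) (auto simp: mult_in power_in)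
    finally show ?case
      by (simp add: mult.assoc)
  qed simp
  from this[OF one_in] show ?thesis
    using assms by (simp add: nilpotents_def mult_in \<sigma>_in)
qed

lemma nil_\<delta>:
  assumes i: "i \<in> {1..n}" and "a \<in> R" "b \<in> R" and "a * b \<in> N"
  shows "a * \<delta> i b \<in> N"
proof -
  have "u * (a * \<delta> i b) ^ m = 0" if "u \<in> R" "u * (a * b) ^ m = 0" for u m
    using that
  proof (induction m arbitrary: u)
    case (Suc m)
    have "(u * a) * b * (a * b) ^ m = 0"
      using Suc.prems by (simp add: mult.assoc)
    then have "(u * a) * \<delta> i b * (a * b) ^ m = 0"
      using Suc.prems assms by (intro zero_\<delta>_inner) (auto simp: mult_in power_in)
    then have "(u * a * \<delta> i b) * (a * \<delta> i b) ^ m = 0"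
      using Suc assms by (simp add: mult_in \<delta>_in)
    then show ?case
      by (simp add: mult.assoc)
  qed simp
  from this[OF one_in] show ?thesis
    using assms by (auto simp: nilpotents_def mult_in \<delta>_in)
qed

text \<open>
  The coefficients that arise from \<open>a\<close> are complicated sums over words in the \<open>\<sigma>\<^sub>i\<close> and
  \<open>\<delta>\<^sub>i\<close>.  The argument uses only how they compare with \<open>a\<close> under this preorder: inclusion of
  left annihilators modulo the nilpotent elements.
\<close>

definition nil_le :: "'a \<Rightarrow> 'a \<Rightarrow> bool" where
  "nil_le a b \<longleftrightarrow> (\<forall>u\<in>R. u * a \<in> N \<longrightarrow> u * b \<in> N)"

lemma nil_le_refl: "nil_le a a"
  and nil_le_trans: "nil_le a b \<Longrightarrow> nil_le b c \<Longrightarrow> nil_le a c"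
  and nil_le_zero: "nil_le a 0"
  and nil_le_add: "nil_le a b \<Longrightarrow> nil_le a c \<Longrightarrow> nil_le a (b + c)"
  by (auto simp: nil_le_def nil_zero nil_add distrib_left)

lemma nil_le_\<sigma>: "i \<in> {1..n} \<Longrightarrow> b \<in> R \<Longrightarrow> nil_le b (\<sigma> i b)"
  and nil_ge_\<sigma>: "i \<in> {1..n} \<Longrightarrow> b \<in> R \<Longrightarrow> nil_le (\<sigma> i b) b"
  and nil_le_\<delta>: "i \<in> {1..n} \<Longrightarrow> b \<in> R \<Longrightarrow> nil_le b (\<delta> i b)"
  by (auto simp: nil_le_def nil_\<sigma> nil_\<delta>)

section \<open>Moving a coefficient across a monomial\<close>

lemma exponents_incr: "i \<in> {1..n} \<Longrightarrow> \<alpha> \<in> exponents n \<Longrightarrow> \<alpha>(i := Suc (\<alpha> i)) \<in> exponents n"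
  by (auto simp: exponents_def)

text \<open>
  From \<open>x\<^sub>i c x^\<alpha> = \<sigma>\<^sub>i(c) x\<^sub>i x^\<alpha> + \<delta>\<^sub>i(c) x^\<alpha>\<close>, term by term; the first summand is already in
  normal form because no variable of \<open>x^\<alpha>\<close> precedes \<open>x\<^sub>i\<close>.
\<close>

lemma coeff_var_times:
  assumes i: "i \<in> {1..n}" and low: "\<And>\<alpha> j. coeff g \<alpha> \<noteq> 0 \<Longrightarrow> j < i \<Longrightarrow> \<alpha> j = 0"
  shows "coeff (x i * g) \<gamma> =
    (if \<gamma> i = 0 then 0 else \<sigma> i (coeff g (\<gamma>(i := \<gamma> i - 1)))) + \<delta> i (coeff g \<gamma>)"
proof -
  let ?S = "{\<alpha>. coeff g \<alpha> \<noteq> 0}"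
  let ?up = "\<lambda>\<alpha>::nat \<Rightarrow> nat. \<alpha>(i := Suc (\<alpha> i))"
  have fin: "finite ?S" by (rule finite_support)
  have "x i * (coeff g \<alpha> * mon \<alpha>) = \<sigma> i (coeff g \<alpha>) * mon (?up \<alpha>) + \<delta> i (coeff g \<alpha>) * mon \<alpha>"
    if "\<alpha> \<in> ?S" for \<alpha>
  proof -
    have "x i * (coeff g \<alpha> * mon \<alpha>) = (x i * coeff g \<alpha>) * mon \<alpha>"
      by (simp add: mult.assoc)
    also have "\<dots> = \<sigma> i (coeff g \<alpha>) * (x i * mon \<alpha>) + \<delta> i (coeff g \<alpha>) * mon \<alpha>"
      by (simp add: var_mult[OF i coeff_in] distrib_right mult.assoc)
    also have "x i * mon \<alpha> = mon (?up \<alpha>)"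
      using that low by (intro var_times_mon i) auto
    finally show ?thesis .
  qed
  then have "x i * g = (\<Sum>\<alpha>\<in>?S. \<sigma> i (coeff g \<alpha>) * mon (?up \<alpha>) + \<delta> i (coeff g \<alpha>) * mon \<alpha>)"
    using arg_cong[OF expand[OF fin subset_refl], of "\<lambda>t. x i * t"] by (simp add: sum_distrib_left)
  then have "coeff (x i * g) \<gamma> =
    (\<Sum>\<alpha>\<in>?S. if \<gamma> = ?up \<alpha> then \<sigma> i (coeff g \<alpha>) else 0) +
    (\<Sum>\<alpha>\<in>?S. if \<gamma> = \<alpha> then \<delta> i (coeff g \<alpha>) else 0)"
    by (simp add: coeff_sum coeff_add coeff_term coeff_in \<sigma>_in[OF i] \<delta>_in[OF i] support_exponents
        exponents_incr[OF i] sum.distrib)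
  also have "(\<Sum>\<alpha>\<in>?S. if \<gamma> = \<alpha> then \<delta> i (coeff g \<alpha>) else 0) = \<delta> i (coeff g \<gamma>)"
    using fin by (auto simp: sum.delta' \<delta>_zero[OF i])
  also have "(\<Sum>\<alpha>\<in>?S. if \<gamma> = ?up \<alpha> then \<sigma> i (coeff g \<alpha>) else 0) =
    (if \<gamma> i = 0 then 0 else \<sigma> i (coeff g (\<gamma>(i := \<gamma> i - 1))))"
  proof (cases "\<gamma> i = 0")
    case True
    then show ?thesis by (auto intro!: sum.neutral simp: fun_eq_iff)
  next
    case False
    then have "\<gamma> = ?up \<alpha> \<longleftrightarrow> \<gamma>(i := \<gamma> i - 1) = \<alpha>" for \<alpha>
      by (auto simp: fun_eq_iff)
    then show ?thesis
      using fin False by (auto simp: sum.delta' \<sigma>_zero[OF i])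
  qed
  finally show ?thesis .
qed

text \<open>
  Induction on the degree, peeling off the first variable \<open>x\<^sub>i\<close> of \<open>x^\<alpha>\<close>.  The statement about
  vanishing exponents is what makes \<open>coeff_var_times\<close> applicable in the next step: no variable
  before \<open>x\<^sub>i\<close> ever appears.  The last statement holds because only \<open>\<sigma>\<^sub>i\<close> raises the degree, so
  the coefficient at \<open>x^\<alpha>\<close> itself is \<open>\<sigma>\<^sub>i\<close> of the previous top coefficient.
\<close>

lemma coeff_mon_times:
  assumes "\<alpha> \<in> exponents n" and a: "a \<in> R"
  shows "(\<forall>\<gamma>. nil_le a (coeff (mon \<alpha> * a) \<gamma>)) \<and>
    (\<forall>\<gamma> j. coeff (mon \<alpha> * a) \<gamma> \<noteq> 0 \<longrightarrow> \<alpha> j = 0 \<longrightarrow> \<gamma> j = 0) \<and>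
    (\<forall>\<gamma>. coeff (mon \<alpha> * a) \<gamma> \<noteq> 0 \<longrightarrow> \<gamma> = \<alpha> \<or> degree_exp n \<gamma> < degree_exp n \<alpha>) \<and>
    nil_le (coeff (mon \<alpha> * a) \<alpha>) a"
  using assms(1)
proof (induction "degree_exp n \<alpha>" arbitrary: \<alpha>)
  case 0
  then have "\<alpha> = (\<lambda>_. 0)"
    by (fastforce simp: degree_exp_def exponents_def fun_eq_iff)
  moreover have "coeff (mon (\<lambda>_. 0) * a) \<gamma> = (if \<gamma> = (\<lambda>_. 0) then a else 0)" for \<gamma>
    using coeff_term[OF a, of "\<lambda>_. 0" \<gamma>] by (simp add: exponents_def)
  ultimately show ?case
    by (simp add: nil_le_refl nil_le_zero)
next
  case (Suc d)
  have "\<exists>i. \<alpha> i \<noteq> 0"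
    by (rule ccontr) (use Suc(2) in \<open>simp add: degree_exp_def\<close>)
  define i where "i = (LEAST i. \<alpha> i \<noteq> 0)"
  have \<alpha>i: "\<alpha> i \<noteq> 0"
    unfolding i_def using \<open>\<exists>i. \<alpha> i \<noteq> 0\<close> by (rule LeastI_ex)
  have low: "\<alpha> j = 0" if "j < i" for j
    using that not_less_Least unfolding i_def by blast
  have i: "i \<in> {1..n}"
    using \<alpha>i Suc.prems by (auto simp: exponents_def)
  define \<beta> where "\<beta> = \<alpha>(i := \<alpha> i - 1)"
  have \<alpha>: "\<alpha> = \<beta>(i := Suc (\<beta> i))"
    using \<alpha>i by (simp add: \<beta>_def fun_eq_iff)
  have \<beta>low: "\<beta> j = 0" if "j < i" for j
    using low that by (simp add: \<beta>_def)
  have deg: "degree_exp n \<alpha> = Suc (degree_exp n \<beta>)"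
    unfolding \<alpha> using i by (simp only: degree_exp_incr)
  have \<beta>: "\<beta> \<in> exponents n"
    using Suc.prems by (auto simp: \<beta>_def exponents_def)
  let ?g = "mon \<beta> * a"
  have IH1: "nil_le a (coeff ?g \<gamma>)"
    and IH2: "coeff ?g \<gamma> \<noteq> 0 \<Longrightarrow> \<beta> j = 0 \<Longrightarrow> \<gamma> j = 0"
    and IH3: "coeff ?g \<gamma> \<noteq> 0 \<Longrightarrow> \<gamma> = \<beta> \<or> degree_exp n \<gamma> < degree_exp n \<beta>"
    and IH4: "nil_le (coeff ?g \<beta>) a" for \<gamma> j
    using Suc(1)[OF _ \<beta>] deg Suc(2) by auto
  have "x i * mon \<beta> = mon \<alpha>"
    unfolding \<alpha> using i \<beta>low by (rule var_times_mon)
  then have "mon \<alpha> * a = x i * ?g"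
    by (metis mult.assoc)
  then have formula: "coeff (mon \<alpha> * a) \<gamma> =
    (if \<gamma> i = 0 then 0 else \<sigma> i (coeff ?g (\<gamma>(i := \<gamma> i - 1)))) + \<delta> i (coeff ?g \<gamma>)" for \<gamma>
    using coeff_var_times[OF i, of ?g] IH2 \<beta>low by simp
  have source: "(\<gamma> i \<noteq> 0 \<and> coeff ?g (\<gamma>(i := \<gamma> i - 1)) \<noteq> 0) \<or> coeff ?g \<gamma> \<noteq> 0"
    if "coeff (mon \<alpha> * a) \<gamma> \<noteq> 0" for \<gamma>
    using that \<sigma>_zero[OF i] \<delta>_zero[OF i] unfolding formula by (auto split: if_splits)
  have "nil_le a (coeff (mon \<alpha> * a) \<gamma>)" for \<gamma>
    unfolding formula
    using nil_le_trans[OF IH1 nil_le_\<sigma>[OF i coeff_in]]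
      nil_le_trans[OF IH1 nil_le_\<delta>[OF i coeff_in]]
    by (simp add: nil_le_add)
  moreover have "\<gamma> j = 0" if nz: "coeff (mon \<alpha> * a) \<gamma> \<noteq> 0" and j: "\<alpha> j = 0" for \<gamma> j
  proof -
    have "j \<noteq> i" "\<beta> j = 0" using j \<alpha>i by (auto simp: \<beta>_def)
    then show ?thesis
      using source[OF nz] IH2[of "\<gamma>(i := \<gamma> i - 1)" j] IH2[of \<gamma> j] by auto
  qed
  moreover have "\<gamma> = \<alpha> \<or> degree_exp n \<gamma> < degree_exp n \<alpha>"
    if nz: "coeff (mon \<alpha> * a) \<gamma> \<noteq> 0" for \<gamma>
    using source[OF nz]
  proof
    assume *: "\<gamma> i \<noteq> 0 \<and> coeff ?g (\<gamma>(i := \<gamma> i - 1)) \<noteq> 0"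
    let ?\<gamma> = "\<gamma>(i := \<gamma> i - 1)"
    have up: "\<gamma> = ?\<gamma>(i := Suc (?\<gamma> i))" using * by (simp add: fun_eq_iff)
    then have "degree_exp n \<gamma> = Suc (degree_exp n ?\<gamma>)"
      using degree_exp_incr[OF i, of ?\<gamma>] by simp
    then show ?thesis
      using IH3[of ?\<gamma>] * up \<alpha> deg by auto
  next
    assume "coeff ?g \<gamma> \<noteq> 0"
    then show ?thesis using IH3[of \<gamma>] deg by auto
  qed
  moreover have "nil_le (coeff (mon \<alpha> * a) \<alpha>) a"
  proof -
    have "coeff ?g \<alpha> = 0"
      using IH3[of \<alpha>] deg by (metis lessI not_less_iff_gr_or_eq)
    then have "coeff (mon \<alpha> * a) \<alpha> = \<sigma> i (coeff ?g \<beta>)"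
      unfolding formula using \<alpha>i \<delta>_zero[OF i] by (simp add: \<beta>_def)
    then show ?thesis
      using nil_ge_\<sigma>[OF i coeff_in[of ?g \<beta>]] IH4 nil_le_trans by metis
  qed
  ultimately show ?case by blast
qed

end

section \<open>Degree-compatible orders\<close>

lemma finite_has_greatest:
  assumes "linear_order_on E r" "finite T" "T \<noteq> {}" "T \<subseteq> E"
  shows "\<exists>m\<in>T. \<forall>t\<in>T. (t, m) \<in> r"
  using assms(2,3,4)
proof (induction T rule: finite_ne_induct)
  case (singleton t)
  then show ?case
    using assms(1) by (auto simp: order_on_defs refl_on_def)
next
  case (insert t T)
  then obtain m where m: "m \<in> T" "\<forall>s\<in>T. (s, m) \<in> r" by auto
  have tt: "(t, t) \<in> r" and tm: "(t, m) \<in> r \<or> (m, t) \<in> r" and tr: "trans r"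
    using assms(1) insert m(1) by (auto simp: order_on_defs refl_on_def total_on_def)
  show ?case
  proof (cases "(t, m) \<in> r")
    case True
    then show ?thesis using m by auto
  next
    case False
    then have "(m, t) \<in> r" using tm by simp
    then have "\<forall>s\<in>T. (s, t) \<in> r" using m(2) tr by (meson transD)
    then show ?thesis using tt by auto
  qed
qed

lemma finite_enumeration:
  assumes lin: "linear_order_on E r" and "finite T" "T \<noteq> {}" "T \<subseteq> E"
  shows "\<exists>l X. X ` {..l::nat} = T \<and> (\<forall>i j. i < j \<and> j \<le> l \<longrightarrow> (X i, X j) \<in> r \<and> X i \<noteq> X j)"
  using assms(2-)
proof (induction T rule: finite_remove_induct)
  case (remove T)
  obtain m where m: "m \<in> T" "\<forall>t\<in>T. (t, m) \<in> r"
    using finite_has_greatest[OF lin] remove by metis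
  show ?case
  proof (cases "T - {m} = {}")
    case True
    then have "(\<lambda>_. m) ` {..0::nat} = T" using m(1) by auto
    then show ?thesis by (intro exI[of _ 0] exI[of _ "\<lambda>_. m"]) simp
  next
    case False
    then have "\<exists>l X. X ` {..l::nat} = T - {m} \<and>
        (\<forall>i j. i < j \<and> j \<le> l \<longrightarrow> (X i, X j) \<in> r \<and> X i \<noteq> X j)"
      using remove.prems by (intro remove.IH m(1)) auto
    then obtain l X where X: "X ` {..l::nat} = T - {m}"
      "\<forall>i j. i < j \<and> j \<le> l \<longrightarrow> (X i, X j) \<in> r \<and> X i \<noteq> X j"
      by (elim exE conjE)
    have below: "(X i, m) \<in> r \<and> X i \<noteq> m" if "i \<le> l" for i
      using X(1) m(2) that by auto
    let ?X = "X(Suc l := m)"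
    have "?X ` {..Suc l} = insert m (X ` {..l})"
      by (auto simp: atMost_Suc)
    then have "?X ` {..Suc l} = T" using X(1) m(1) by auto
    moreover have "(?X i, ?X j) \<in> r \<and> ?X i \<noteq> ?X j" if "i < j" "j \<le> Suc l" for i j
      using that X(2)[rule_format, of i j] below[of i] by (cases "j = Suc l") auto
    ultimately show ?thesis by blast
  qed
qed simp

lemma finite_bounded_degree: "finite {\<alpha> \<in> exponents n. degree_exp n \<alpha> \<le> d}"
proof (rule finite_subset)
  show "{\<alpha> \<in> exponents n. degree_exp n \<alpha> \<le> d} \<subseteq>
    {\<alpha>. \<forall>i. (i \<in> {1..n} \<longrightarrow> \<alpha> i \<in> {..d}) \<and> (i \<notin> {1..n} \<longrightarrow> \<alpha> i = 0)}"
  proof clarify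
    fix \<alpha> i
    assume \<alpha>: "\<alpha> \<in> exponents n" "degree_exp n \<alpha> \<le> d"
    have "\<alpha> i \<le> degree_exp n \<alpha>" if "i \<in> {1..n}"
      unfolding degree_exp_def using that by (intro member_le_sum) auto
    then show "(i \<in> {1..n} \<longrightarrow> \<alpha> i \<in> {..d}) \<and> (i \<notin> {1..n} \<longrightarrow> \<alpha> i = 0)"
      using \<alpha> by (auto simp: exponents_def)
  qed
qed (intro finite_set_of_finite_funs; simp)

locale ordered_skew_PBW = skew_PBW R n x \<sigma> \<delta>
  for R :: "'a::ring_1 set" and n x \<sigma> \<delta> +
  fixes ord :: "(nat \<Rightarrow> nat) rel"
  assumes monord: "monomial_order R n x ord"
begin

lemma lin: "linear_order_on (exponents n) ord"
  and ord_zero: "\<alpha> \<in> exponents n \<Longrightarrow> ((\<lambda>_. 0), \<alpha>) \<in> ord"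
  and ord_degree: "\<alpha> \<in> exponents n \<Longrightarrow> \<beta> \<in> exponents n \<Longrightarrow>
    degree_exp n \<alpha> < degree_exp n \<beta> \<Longrightarrow> (\<alpha>, \<beta>) \<in> ord"
  using monord by (auto simp: monomial_order_def)

lemma ord_refl: "\<alpha> \<in> exponents n \<Longrightarrow> (\<alpha>, \<alpha>) \<in> ord"
  and ord_antisym: "(\<alpha>, \<beta>) \<in> ord \<Longrightarrow> (\<beta>, \<alpha>) \<in> ord \<Longrightarrow> \<alpha> = \<beta>"
  and ord_trans: "(\<alpha>, \<beta>) \<in> ord \<Longrightarrow> (\<beta>, \<gamma>) \<in> ord \<Longrightarrow> (\<alpha>, \<gamma>) \<in> ord"
  and ord_in: "(\<alpha>, \<beta>) \<in> ord \<Longrightarrow> \<alpha> \<in> exponents n \<and> \<beta> \<in> exponents n"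
proof -
  have props: "ord \<subseteq> exponents n \<times> exponents n" "refl_on (exponents n) ord" "trans ord"
    "antisym ord"
    using lin by (simp_all add: order_on_defs)
  show "\<alpha> \<in> exponents n \<Longrightarrow> (\<alpha>, \<alpha>) \<in> ord" for \<alpha>
    using props(2) by (rule refl_onD)
  show "(\<alpha>, \<beta>) \<in> ord \<Longrightarrow> (\<beta>, \<alpha>) \<in> ord \<Longrightarrow> \<alpha> = \<beta>"
    using props(4) by (rule antisymD)
  show "(\<alpha>, \<beta>) \<in> ord \<Longrightarrow> (\<beta>, \<gamma>) \<in> ord \<Longrightarrow> (\<alpha>, \<gamma>) \<in> ord"
    using props(3) by (rule transD)
  show "(\<alpha>, \<beta>) \<in> ord \<Longrightarrow> \<alpha> \<in> exponents n \<and> \<beta> \<in> exponents n"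
    using props(1) by auto
qed

text \<open>
  Degree compatibility bounds the degree of every smaller monomial.
\<close>

lemma finite_below: "finite {\<beta>. (\<beta>, \<alpha>) \<in> ord}"
proof (rule finite_subset[OF _ finite_bounded_degree])
  show "{\<beta>. (\<beta>, \<alpha>) \<in> ord} \<subseteq> {\<beta> \<in> exponents n. degree_exp n \<beta> \<le> degree_exp n \<alpha>}"
  proof clarify
    fix \<beta> assume \<beta>: "(\<beta>, \<alpha>) \<in> ord"
    then have exp: "\<beta> \<in> exponents n" "\<alpha> \<in> exponents n" using ord_in by auto
    moreover have "\<not> degree_exp n \<alpha> < degree_exp n \<beta>"
      using ord_degree[OF exp(2,1)] ord_antisym[OF \<beta>] by auto
    ultimately show "\<beta> \<in> exponents n \<and> degree_exp n \<beta> \<le> degree_exp n \<alpha>" by simp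
  qed
qed

lemma card_below_less:
  assumes "(\<beta>, \<alpha>) \<in> ord" "\<beta> \<noteq> \<alpha>"
  shows "card {\<gamma>. (\<gamma>, \<beta>) \<in> ord} < card {\<gamma>. (\<gamma>, \<alpha>) \<in> ord}"
proof (rule psubset_card_mono[OF finite_below])
  show "{\<gamma>. (\<gamma>, \<beta>) \<in> ord} \<subset> {\<gamma>. (\<gamma>, \<alpha>) \<in> ord}"
    using assms ord_trans ord_antisym ord_refl ord_in by blast
qed

lemma coeff_mon_times_ord:
  assumes "\<alpha> \<in> exponents n" "a \<in> R" "coeff (mon \<alpha> * a) \<gamma> \<noteq> 0"
  shows "(\<gamma>, \<alpha>) \<in> ord"
  using coeff_mon_times[OF assms(1,2)] assms ord_degree ord_refl support_exponents by metis

section \<open>The leading coefficient modulo nilpotents\<close>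

definition nil_lead :: "'a \<Rightarrow> (nat \<Rightarrow> nat) \<Rightarrow> bool" where
  "nil_lead g \<kappa> \<longleftrightarrow> coeff g \<kappa> \<notin> N \<and> (\<forall>\<alpha>. coeff g \<alpha> \<notin> N \<longrightarrow> (\<alpha>, \<kappa>) \<in> ord)"

lemma greatest_not_nil:
  assumes "\<And>\<alpha>. P \<alpha> \<Longrightarrow> coeff g \<alpha> \<notin> N" "P \<alpha>"
  obtains \<kappa> where "P \<kappa>" "\<And>\<beta>. P \<beta> \<Longrightarrow> (\<beta>, \<kappa>) \<in> ord"
proof -
  have "{\<beta>. P \<beta>} \<subseteq> {\<beta>. coeff g \<beta> \<noteq> 0}"
    using assms(1) nil_zero by fastforce
  then have "finite {\<beta>. P \<beta>}" "{\<beta>. P \<beta>} \<subseteq> exponents n"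
    using finite_support finite_subset support_exponents by blast+
  then show ?thesis
    using finite_has_greatest[OF lin, of "{\<beta>. P \<beta>}"] assms(2) that by blast
qed

lemma ex_nil_lead:
  assumes "g \<notin> coeffs_in N n x"
  obtains \<kappa> where "nil_lead g \<kappa>"
proof -
  obtain \<alpha> where "coeff g \<alpha> \<notin> N"
    using assms in_coeffs_in_nilpotents by blast
  then obtain \<kappa> where "coeff g \<kappa> \<notin> N" "\<And>\<beta>. coeff g \<beta> \<notin> N \<Longrightarrow> (\<beta>, \<kappa>) \<in> ord"
    using greatest_not_nil[of "\<lambda>\<beta>. coeff g \<beta> \<notin> N" g \<alpha>] by blast
  then have "nil_lead g \<kappa>"
    unfolding nil_lead_def by simp
  then show thesis by (rule that)
qed

text \<open>
  A coefficient of \<open>g * a\<close> outside \<open>N\<close> comes from a term of \<open>g\<close> whose coefficient is outside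
  \<open>N\<close>, hence from a monomial at most \<open>\<kappa>\<close>; the term at \<open>\<kappa>\<close> contributes nothing modulo \<open>N\<close>.
\<close>

lemma nil_lead_decreases:
  assumes lead: "nil_lead g \<kappa>" and a: "a \<in> R" and kill: "coeff g \<kappa> * a \<in> N"
    and nz: "coeff (g * a) \<gamma> \<notin> N"
  shows "(\<gamma>, \<kappa>) \<in> ord \<and> \<gamma> \<noteq> \<kappa>"
proof -
  obtain \<alpha> where \<alpha>: "coeff g \<alpha> \<noteq> 0" "coeff g \<alpha> * coeff (mon \<alpha> * a) \<gamma> \<notin> N"
    using nz nil_sum[of "{\<alpha>. coeff g \<alpha> \<noteq> 0}" "\<lambda>\<alpha>. coeff g \<alpha> * coeff (mon \<alpha> * a) \<gamma>"]
    by (auto simp only: coeff_times[of g a] mem_Collect_eq)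
  have exp: "\<alpha> \<in> exponents n" using \<alpha>(1) by (rule support_exponents)
  have "coeff g \<alpha> \<notin> N"
    using \<alpha>(2) nil_mult_right coeff_in by blast
  then have "(\<alpha>, \<kappa>) \<in> ord"
    using lead by (simp add: nil_lead_def)
  moreover have "(\<gamma>, \<alpha>) \<in> ord"
    using \<alpha>(2) nil_zero by (intro coeff_mon_times_ord[OF exp a]) auto
  moreover have "\<alpha> \<noteq> \<kappa>"
    using \<alpha>(2) kill coeff_mon_times[OF exp a] coeff_in unfolding nil_le_def by blast
  ultimately show ?thesis
    using ord_trans ord_antisym by blast
qed

text \<open>
  Take the greatest monomial \<open>\<nu>\<close> whose coefficient is not killed by \<open>a\<close>.  Larger terms vanish
  modulo \<open>N\<close> and smaller ones do not reach \<open>\<nu>\<close>, so the coefficient of \<open>g * a\<close> at \<open>\<nu>\<close> is,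
  modulo \<open>N\<close>, the contribution of the term at \<open>\<nu>\<close> alone, which survives.
\<close>

lemma not_all_nil_times:
  assumes a: "a \<in> R" and \<mu>: "coeff g \<mu> * a \<notin> N"
  shows "g * a \<notin> coeffs_in N n x"
proof -
  obtain \<nu> where \<nu>: "coeff g \<nu> * a \<notin> N" and max: "\<And>\<beta>. coeff g \<beta> * a \<notin> N \<Longrightarrow> (\<beta>, \<nu>) \<in> ord"
    using greatest_not_nil[of "\<lambda>\<alpha>. coeff g \<alpha> * a \<notin> N" g] nil_mult_right a \<mu> by metis
  let ?S = "{\<alpha>. coeff g \<alpha> \<noteq> 0}"
  let ?t = "\<lambda>\<alpha>. coeff g \<alpha> * coeff (mon \<alpha> * a) \<nu>"
  have \<nu>S: "\<nu> \<in> ?S" using \<nu> nil_zero by auto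
  then have \<nu>exp: "\<nu> \<in> exponents n" using support_exponents by auto
  have rest: "?t \<alpha> \<in> N" if "\<alpha> \<in> ?S - {\<nu>}" for \<alpha>
  proof (rule ccontr)
    assume t: "?t \<alpha> \<notin> N"
    have exp: "\<alpha> \<in> exponents n" using that support_exponents by auto
    have "coeff g \<alpha> * a \<notin> N"
      using t coeff_mon_times[OF exp a] coeff_in unfolding nil_le_def by blast
    then have "(\<alpha>, \<nu>) \<in> ord" by (rule max)
    moreover have "(\<nu>, \<alpha>) \<in> ord"
      using t nil_zero by (intro coeff_mon_times_ord[OF exp a]) auto
    ultimately show False using ord_antisym that by blast
  qed
  have "?t \<nu> \<notin> N"
    using \<nu> coeff_mon_times[OF \<nu>exp a] coeff_in unfolding nil_le_def by blast
  moreover have "coeff (g * a) \<nu> = ?t \<nu> + (\<Sum>\<alpha>\<in>?S - {\<nu>}. ?t \<alpha>)"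
    unfolding coeff_times[of g a] using finite_support \<nu>S by (rule sum.remove)
  moreover have "(\<Sum>\<alpha>\<in>?S - {\<nu>}. ?t \<alpha>) \<in> N"
    using rest by (rule nil_sum)
  ultimately have "coeff (g * a) \<nu> \<notin> N"
    using nil_diff[of "coeff (g * a) \<nu>" "\<Sum>\<alpha>\<in>?S - {\<nu>}. ?t \<alpha>"]
    by (simp only: add_diff_cancel_right') blast
  then show ?thesis
    using in_coeffs_in_nilpotents by blast
qed

section \<open>Nilpotent good polynomials\<close>

text \<open>
  The standard form lists the support of \<open>g\<close> in increasing order.  The monomial \<open>1\<close> is
  inserted even if its coefficient is \<open>0\<close>, since a standard form must start with it.
\<close>

lemma nilpotent_goodI:
  assumes lead: "nil_lead g \<kappa>"
    and ann: "\<And>\<mu>. weak_annihilator R {coeff g \<kappa>} \<subseteq> weak_annihilator R {coeff g \<mu>}"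
  shows "nilpotent_good R n x ord g"
proof -
  let ?T = "insert (\<lambda>_. 0) {\<alpha>. coeff g \<alpha> \<noteq> 0}"
  have T: "finite ?T" "?T \<subseteq> exponents n"
    using finite_support support_exponents by (auto simp: exponents_def)
  obtain l X where X: "X ` {..l::nat} = ?T"
    "\<forall>i j. i < j \<and> j \<le> l \<longrightarrow> (X i, X j) \<in> ord \<and> X i \<noteq> X j"
    using finite_enumeration[OF lin T(1) insert_not_empty T(2)] by (elim exE conjE)
  have Xexp: "X i \<in> exponents n" if "i \<le> l" for i
    using X(1) T(2) that by blast
  have X0: "X 0 = (\<lambda>_. 0)"
  proof -
    obtain i where i: "i \<le> l" "X i = (\<lambda>_. 0)"
    proof -
      have "(\<lambda>_. 0) \<in> X ` {..l}" by (simp add: X(1))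
      then show thesis using that by auto
    qed
    have "((\<lambda>_. 0), X 0) \<in> ord" using ord_zero Xexp by simp
    then show ?thesis using X(2)[rule_format, of 0 i] i ord_antisym by (cases "i = 0") auto
  qed
  have "inj_on X {..l}"
    by (rule linorder_inj_onI) (use X(2) in auto)
  then have "(\<Sum>\<alpha>\<in>?T. coeff g \<alpha> * mon \<alpha>) = (\<Sum>i\<le>l. coeff g (X i) * mon (X i))"
    by (simp add: X(1)[symmetric] sum.reindex)
  then have "g = (\<Sum>i\<le>l. coeff g (X i) * mon (X i))"
    using expand[OF T(1) subset_insertI] by simp
  then have form: "standard_form R n x ord g l (\<lambda>i. coeff g (X i)) X"
    unfolding standard_form_def using X(2) X0 Xexp coeff_in by auto
  have "coeff g \<kappa> \<noteq> 0" using lead nil_zero by (auto simp: nil_lead_def)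
  then have "\<kappa> \<in> X ` {..l}" by (simp add: X(1))
  then obtain k where k: "k \<le> l" "X k = \<kappa>" by auto
  have "nilpotent_degree R l (\<lambda>i. coeff g (X i)) k"
    unfolding nilpotent_degree_def
  proof (intro conjI allI impI)
    show "coeff g (X i) \<in> N" if "k < i \<and> i \<le> l" for i
      using lead k X(2) that ord_antisym unfolding nil_lead_def by metis
  qed (use lead k in \<open>auto simp: nil_lead_def\<close>)
  moreover have "g \<notin> coeffs_in N n x"
    using lead by (auto simp: in_coeffs_in_nilpotents nil_lead_def)
  ultimately show ?thesis
    unfolding nilpotent_good_def using form ann k(2) by blast
qed

lemma ex_nilpotent_good_multiple:
  assumes "nil_lead g \<kappa>"
  shows "\<exists>r\<in>R. nilpotent_good R n x ord (g * r)"
  using assms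
proof (induction "card {\<gamma>. (\<gamma>, \<kappa>) \<in> ord}" arbitrary: g \<kappa> rule: less_induct)
  case less
  show ?case
  proof (cases "\<forall>\<mu>. weak_annihilator R {coeff g \<kappa>} \<subseteq> weak_annihilator R {coeff g \<mu>}")
    case True
    then have "nilpotent_good R n x ord (g * 1)"
      using nilpotent_goodI[OF less.prems] by simp
    then show ?thesis using one_in by blast
  next
    case False
    then obtain a \<mu> where a: "a \<in> R" "coeff g \<kappa> * a \<in> N" "coeff g \<mu> * a \<notin> N"
      by (auto simp: weak_annihilator_def)
    obtain \<nu> where \<nu>: "nil_lead (g * a) \<nu>"
      using ex_nil_lead not_all_nil_times[OF a(1,3)] by blast
    have "(\<nu>, \<kappa>) \<in> ord \<and> \<nu> \<noteq> \<kappa>"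
      using nil_lead_decreases[OF less.prems a(1,2)] \<nu> by (simp add: nil_lead_def)
    then obtain r where "r \<in> R" "nilpotent_good R n x ord (g * a * r)"
      using less.hyps[OF _ \<nu>] card_below_less by blast
    then show ?thesis
      using mult_in[OF a(1)] by (metis mult.assoc)
  qed
qed

end

theorem theorem4p3:
  fixes R :: "'a::ring_1 set" and n :: nat and x :: "nat \<Rightarrow> 'a"
    and \<sigma> \<delta> :: "nat \<Rightarrow> 'a \<Rightarrow> 'a" and ord :: "(nat \<Rightarrow> nat) rel" and f :: 'a
  assumes "skew_PBW_extension R n x"
    and "pbw_structure_maps R n x \<sigma> \<delta>"
    and "Sigma_Delta_compatible R n \<sigma> \<delta>"
    and "NI_ring R"
    and "monomial_order R n x ord"
    and "f \<notin> coeffs_in (nilpotents R) n x"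
  shows "\<exists>r\<in>R. nilpotent_good R n x ord (f * r)"
proof -
  interpret ordered_skew_PBW R n x \<sigma> \<delta> ord
    using assms(1-5) by unfold_locales
  obtain \<kappa> where "nil_lead f \<kappa>"
    using ex_nil_lead assms(6) by blast
  then show ?thesis
    by (rule ex_nilpotent_good_multiple)
qed

end
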